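(* Let $(X,\|\cdot\|)$ be a real normed space, $n\ge2$, and let $\Omega_1,\ldots,\Omega_n\subset X$ be nonempty closed convex sets. Let $\mathrm{Sol}$ be the set of all global minimisers over $X$ of $$f(x):=\max\{d(x,\Omega_1),\ldots,d(x,\Omega_n)\},\quad x\in X,$$ and let $\bar x\in X$ with $\bar x\notin\bigcup_{i=1}^n\Omega_i$. Then the following assertions hold. (i) $\bar x\in\mathrm{Sol}$ if and only if there exist $(\lambda_1,\ldots,\lambda_n)\in\mathbb{R}^n_+$ and $x_i^*\in\partial d(\cdot,\Omega_i)(\bar x)$ $(i=1,\ldots,n)$ such that $$\sum_{i=1}^n\lambda_ix_i^*=0,\quad\sum_{i=1}^n\lambda_i=1,\quad\Big(d(\bar x,\Omega_i)-\max_{1\le j\le n}d(\bar x,\Omega_j)\Big)\cdot\lambda_i=0\ (i=1,\ldots,n).\qquad(\ast)$$ (ii) Let $(\lambda_1,\ldots,\lambda_n)\in\mathbb{R}^n_+$ and $x_i^*\in\partial d(\cdot,\Omega_i)(\bar x)$ $(i=1,\ldots,n)$ satisfy $(\ast)$. Then $$\mathrm{Sol}=\bigcap_{i:\,\lambda_i>0}\mathbf{B}(\Omega_i,x_i^* ),$$ where $\mathbf{B}(\Omega_i,x_i^* ):=\mathbf{A}(\Omega_i,x_i^* )\cap\mathbf{C}(\Omega_i)$ with $$\mathbf{A}(\Omega_i,x_i^* ):=\{x\in X\mid x_i^*\in\partial d(\cdot,\Omega_i)(x)\},\qquad \mathbf{C}(\Omega_i):=\Big\{x\in X\mid d(x,\Omega_i)=\max_{1\le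 j\le n}d(x,\Omega_j)\Big\}.$$
   Context: $X^*$ is the topological dual of $X$ with pairing $\langle\cdot,\cdot\rangle$. $d(x,\Omega):=\inf_{u\in\Omega}\|x-u\|$. For a convex function $g:X\to\mathbb{R}$, $\partial g(\bar x):=\{x^*\in X^*\mid\langle x^*,x-\bar x\rangle\le g(x)-g(\bar x)\ \text{for all } x\in X\}$. $\mathbb{R}^n_+$ is the set of vectors in $\mathbb{R}^n$ with nonnegative components. *)

theory Defs
  imports "HOL-Analysis.Analysis"
begin

text \<open>The topological dual of \<open>X\<close> is the space \<open>'a \<Rightarrow>\<^sub>L real\<close> of bounded linear functionals.\<close>

definition subdifferential ::
  "('a::real_normed_vector \<Rightarrow> real) \<Rightarrow> 'a \<Rightarrow> ('a \<Rightarrow>\<^sub>L real) set" where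
  "subdifferential g xb = {xs. \<forall>x. blinfun_apply xs (x - xb) \<le> g x - g xb}"

text \<open>Families \<open>\<Omega>\<^sub>1, \<dots>, \<Omega>\<^sub>n\<close> are functions on \<open>nat\<close> that are only used on the index
  set \<open>{1..n}\<close>. The distance \<open>d(x, \<Omega>)\<close> is \<open>infdist x \<Omega>\<close>, which is the infimum of
  \<open>\<parallel>x - u\<parallel>\<close> over \<open>u \<in> \<Omega>\<close> whenever \<open>\<Omega>\<close> is nonempty.\<close>

definition max_infdist :: "nat \<Rightarrow> (nat \<Rightarrow> 'a::real_normed_vector set) \<Rightarrow> 'a \<Rightarrow> real" where
  "max_infdist n \<Omega> x = Max ((\<lambda>i. infdist x (\<Omega> i)) ` {1..n})"

definition Sol :: "nat \<Rightarrow> (nat \<Rightarrow> 'a::real_normed_vector set) \<Rightarrow> 'a set" where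
  "Sol n \<Omega> = {x. is_arg_min (max_infdist n \<Omega>) (\<lambda>y. y \<in> UNIV) x}"

definition multiplier_system ::
  "nat \<Rightarrow> (nat \<Rightarrow> 'a::real_normed_vector set) \<Rightarrow> 'a \<Rightarrow> (nat \<Rightarrow> real) \<Rightarrow> (nat \<Rightarrow> 'a \<Rightarrow>\<^sub>L real) \<Rightarrow> bool" where
  "multiplier_system n \<Omega> xb l xs \<longleftrightarrow>
     (\<Sum>i=1..n. l i *\<^sub>R xs i) = 0 \<and>
     (\<Sum>i=1..n. l i) = 1 \<and>
     (\<forall>i\<in>{1..n}. (infdist xb (\<Omega> i) - max_infdist n \<Omega> xb) * l i = 0)"

definition A_set :: "'a::real_normed_vector set \<Rightarrow> ('a \<Rightarrow>\<^sub>L real) \<Rightarrow> 'a set" where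
  "A_set S xs = {x. xs \<in> subdifferential (\<lambda>y. infdist y S) x}"

definition C_set :: "nat \<Rightarrow> (nat \<Rightarrow> 'a::real_normed_vector set) \<Rightarrow> nat \<Rightarrow> 'a set" where
  "C_set n \<Omega> i = {x. infdist x (\<Omega> i) = max_infdist n \<Omega> x}"

definition B_set ::
  "nat \<Rightarrow> (nat \<Rightarrow> 'a::real_normed_vector set) \<Rightarrow> nat \<Rightarrow> ('a \<Rightarrow>\<^sub>L real) \<Rightarrow> 'a set" where
  "B_set n \<Omega> i xs = A_set (\<Omega> i) xs \<inter> C_set n \<Omega> i"

end

theory Submission
  imports Defs
begin

text \<open>
  The minimal value \<open>m\<close> of \<open>f\<close> is the infimum of \<open>max\<^sub>i \<parallel>x - u\<^sub>i\<parallel>\<close> over \<open>x \<in> X\<close> and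
  \<open>u\<^sub>i \<in> \<Omega>\<^sub>i\<close>, hence the distance to the origin of a convex subset of \<open>X\<^sup>n\<close> with the maximum norm.
  By Hahn--Banach a functional \<open>(F\<^sub>1, \<dots>, F\<^sub>n)\<close> with \<open>\<Sum>\<^sub>i \<parallel>F\<^sub>i\<parallel> \<le> 1\<close> is at least \<open>m\<close> on that
  set. Being bounded below in \<open>x\<close>, the sum of the \<open>F\<^sub>i\<close> vanishes, and with \<open>\<lambda>\<^sub>i = \<parallel>F\<^sub>i\<parallel>\<close> the chain
  \<open>m \<le> \<Sum>\<^sub>i \<lambda>\<^sub>i d(xb, \<Omega>\<^sub>i) \<le> m \<Sum>\<^sub>i \<lambda>\<^sub>i \<le> m\<close> collapses to equalities, where \<open>m > 0\<close> because
  \<open>xb\<close> lies outside the closed sets. This gives complementarity, \<open>\<Sum>\<^sub>i \<lambda>\<^sub>i = 1\<close>, and that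
  \<open>F\<^sub>i / \<lambda>\<^sub>i\<close> is a subgradient of the distance. Sufficiency and part (ii) come from summing the
  subgradient inequalities with weights \<open>\<lambda>\<^sub>i\<close>; between two minimisers all of them are equalities.

  Hahn--Banach itself follows from Zorn's lemma: a minimal sublinear functional below a given one
  is linear.
\<close>

subsection \<open>Sublinear functionals and Hahn--Banach separation\<close>

definition sublinear :: "('a::real_vector \<Rightarrow> real) \<Rightarrow> bool" where
  "sublinear q \<longleftrightarrow> (\<forall>x y. q (x + y) \<le> q x + q y) \<and> (\<forall>t x. 0 \<le> t \<longrightarrow> q (t *\<^sub>R x) = t * q x)"

lemma sublinear_add: "sublinear q \<Longrightarrow> q (x + y) \<le> q x + q y"
  by (simp add: sublinear_def)

lemma sublinear_scaleR: "sublinear q \<Longrightarrow> 0 \<le> t \<Longrightarrow> q (t *\<^sub>R x) = t * q x"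
  by (simp add: sublinear_def)

lemma sublinear_zero: "sublinear q \<Longrightarrow> q 0 = 0"
  using sublinear_scaleR[of q 0 0] by simp

lemma sublinear_uminus_ge: "sublinear q \<Longrightarrow> - q (- x) \<le> q x"
  using sublinear_add[of q x "- x"] sublinear_zero[of q] by simp

text \<open>One inequality for positive factors is enough: applied to \<open>inverse t\<close> and
  \<open>t *\<^sub>R x\<close> it gives the reverse one.\<close>

lemma sublinearI:
  fixes q :: "'a::real_vector \<Rightarrow> real"
  assumes add: "\<And>x y. q (x + y) \<le> q x + q y"
    and zero: "q 0 = 0"
    and scale: "\<And>t x. 0 < t \<Longrightarrow> q (t *\<^sub>R x) \<le> t * q x"
  shows "sublinear q"
  unfolding sublinear_def
proof (intro conjI allI impI)
  fix x y show "q (x + y) \<le> q x + q y" by (rule add)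
next
  fix t :: real and x :: 'a
  assume "0 \<le> t"
  show "q (t *\<^sub>R x) = t * q x"
  proof (cases "t = 0")
    case True then show ?thesis by (simp add: zero)
  next
    case False
    with \<open>0 \<le> t\<close> have t: "0 < t" by simp
    have "q x \<le> q (t *\<^sub>R x) / t"
      using scale[of "inverse t" "t *\<^sub>R x"] t by (simp add: field_simps)
    then have "t * q x \<le> q (t *\<^sub>R x)"
      using t by (simp add: field_simps)
    with scale[OF t, of x] show ?thesis by linarith
  qed
qed

text \<open>The infimum over \<open>t \<ge> 0\<close> and \<open>c \<in> C\<close> of
  \<open>q (x + t *\<^sub>R c) - t * b\<close> is the largest such functional. A linear functional
  below it is at least \<open>b\<close> on \<open>C\<close>, so this is the step that turns
  domination into separation.\<close>

lemma sublinear_INF_convex: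
  fixes q :: "'a::real_vector \<Rightarrow> real"
  assumes q: "sublinear q" and C: "convex C" "C \<noteq> {}" and b: "\<And>c. c \<in> C \<Longrightarrow> b \<le> q c"
  obtains r where "sublinear r" "\<And>x. r x \<le> q x" "\<And>c. c \<in> C \<Longrightarrow> r (- c) \<le> - b"
proof -
  define g where "g x p = q (x + fst p *\<^sub>R snd p) - fst p * b" for x :: 'a and p :: "real \<times> 'a"
  define D where "D = {0::real..} \<times> C"
  define r where "r x = (INF p\<in>D. g x p)" for x
  obtain c0 where c0: "c0 \<in> C" using C by blast
  have D0: "(0, c0) \<in> D" using c0 by (simp add: D_def)
  \<comment> \<open>Since \<open>q\<close> is at least \<open>b\<close> on \<open>C\<close>, the
    subtracted \<open>t * b\<close> is paid for by \<open>q (t *\<^sub>R c)\<close>, and the infimum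
    stays finite.\<close>
  have lower: "- q (- x) \<le> g x p" if p: "p \<in> D" for x p
  proof -
    obtain t c where tc: "p = (t, c)" by force
    have t: "0 \<le> t" and c: "c \<in> C" using p by (auto simp: tc D_def)
    have "q (t *\<^sub>R c) \<le> q (x + t *\<^sub>R c) + q (- x)"
      using sublinear_add[OF q, of "x + t *\<^sub>R c" "- x"] by simp
    moreover have "t * b \<le> q (t *\<^sub>R c)"
      using b[OF c] t by (simp add: sublinear_scaleR[OF q] mult_left_mono)
    ultimately show ?thesis by (simp add: g_def tc)
  qed
  have bdd: "bdd_below (g x ` D)" for x
    by (rule bdd_belowI2) (rule lower)
  have r_le: "r x \<le> g x p" if "p \<in> D" for x p
    unfolding r_def by (rule cINF_lower[OF bdd that])
  have r_ge: "a \<le> r x" if "\<And>p. p \<in> D \<Longrightarrow> a \<le> g x p" for a x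
    unfolding r_def using D0 that by (intro cINF_greatest) auto
  have r_le_q: "r x \<le> q x" for x
    using r_le[OF D0, of x] by (simp add: g_def)
  have comb: "r (x + y) \<le> g x p + g y p'" if p: "p \<in> D" and p': "p' \<in> D" for x y p p'
  proof -
    obtain t c where tc: "p = (t, c)" by force
    obtain s d where sd: "p' = (s, d)" by force
    have t: "0 \<le> t" "0 \<le> s" and c: "c \<in> C" "d \<in> C" using p p' by (auto simp: tc sd D_def)
    \<comment> \<open>The weighted mean of \<open>c\<close> and \<open>d\<close> lies in
      \<open>C\<close> by convexity; if both weights vanish, any point of \<open>C\<close>
      serves.\<close>
    obtain e where e: "e \<in> C" "(t + s) *\<^sub>R e = t *\<^sub>R c + s *\<^sub>R d"
    proof (cases "t + s = 0")
      case True
      then have "t = 0" "s = 0" using t by auto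
      then show ?thesis using that[of c] c by simp
    next
      case False
      then have "(t / (t + s)) *\<^sub>R c + (s / (t + s)) *\<^sub>R d \<in> C"
        using t c by (intro convexD[OF C(1)]) (auto simp: add_divide_distrib[symmetric])
      then show ?thesis
        using that False by (simp add: scaleR_add_right)
    qed
    have "r (x + y) \<le> g (x + y) (t + s, e)"
      using e t by (intro r_le) (simp add: D_def)
    also have "\<dots> = q ((x + t *\<^sub>R c) + (y + s *\<^sub>R d)) - (t + s) * b"
      by (simp only: g_def e fst_conv snd_conv) (simp add: algebra_simps)
    also have "\<dots> \<le> g x p + g y p'"
      using sublinear_add[OF q, of "x + t *\<^sub>R c" "y + s *\<^sub>R d"]
      by (simp add: g_def tc sd algebra_simps)
    finally show ?thesis .
  qed
  have "sublinear r"
  proof (rule sublinearI)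
    fix x y
    \<comment> \<open>The two infima are taken one after the other, first over \<open>p\<close> with
      \<open>p'\<close> fixed, then over \<open>p'\<close>.\<close>
    have "r (x + y) - g y p' \<le> r x" if "p' \<in> D" for p'
      by (rule r_ge) (use comb that in \<open>simp add: algebra_simps\<close>)
    then have "r (x + y) - r x \<le> r y"
      by (intro r_ge) (simp add: algebra_simps)
    then show "r (x + y) \<le> r x + r y" by simp
  next
    show "r 0 = 0"
      using r_le_q[of 0] r_ge[of "- q (- 0)" 0] lower[of _ 0] sublinear_zero[OF q]
      by fastforce
  next
    fix t :: real and x :: 'a
    assume t: "0 < t"
    have "r (t *\<^sub>R x) / t \<le> r x"
    proof (rule r_ge)
      fix p assume p: "p \<in> D"
      obtain s c where sc: "p = (s, c)" by force
      have "r (t *\<^sub>R x) \<le> g (t *\<^sub>R x) (t * s, c)"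
        using p t by (intro r_le) (simp add: D_def sc)
      also have "\<dots> = q (t *\<^sub>R (x + s *\<^sub>R c)) - t * s * b"
        by (simp add: g_def algebra_simps)
      also have "\<dots> = t * g x p"
        using t by (simp only: sublinear_scaleR[OF q] less_imp_le) (simp add: g_def sc algebra_simps)
      finally show "r (t *\<^sub>R x) / t \<le> g x p"
        using t by (simp add: field_simps)
    qed
    then show "r (t *\<^sub>R x) \<le> t * r x"
      using t by (simp add: field_simps)
  qed
  moreover have "r (- c) \<le> - b" if "c \<in> C" for c
    using r_le[of "(1, c)" "- c"] that sublinear_zero[OF q] by (simp add: D_def g_def)
  ultimately show ?thesis
    using that r_le_q by blast
qed

text \<open>The pointwise infimum is finite because every member is at least
  \<open>- p (- x)\<close> at \<open>x\<close>. A sum \<open>q x + q' y\<close> of values of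
  different members is bounded below by using the smaller of the two for both arguments, which gives
  subadditivity.\<close>

lemma sublinear_INF_chain:
  fixes Q :: "('a::real_vector \<Rightarrow> real) set"
  assumes ne: "Q \<noteq> {}" and sub: "\<And>q. q \<in> Q \<Longrightarrow> sublinear q"
    and chain: "\<And>q q'. q \<in> Q \<Longrightarrow> q' \<in> Q \<Longrightarrow> q \<le> q' \<or> q' \<le> q"
    and p: "\<And>q. q \<in> Q \<Longrightarrow> q \<le> p"
  obtains r where "sublinear r" "\<And>q. q \<in> Q \<Longrightarrow> r \<le> q"
proof -
  define r where "r x = (INF q\<in>Q. q x)" for x
  have lower: "- p (- x) \<le> q x" if "q \<in> Q" for x q
    using sublinear_uminus_ge[OF sub[OF that], of x] le_funD[OF p[OF that], of "- x"] by linarith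
  have bdd: "bdd_below ((\<lambda>q. q x) ` Q)" for x
    using lower by (auto simp: bdd_below_def)
  have r_le: "r x \<le> q x" if "q \<in> Q" for x q
    unfolding r_def by (rule cINF_lower[OF bdd that])
  have r_ge: "a \<le> r x" if "\<And>q. q \<in> Q \<Longrightarrow> a \<le> q x" for a x
    unfolding r_def using ne that by (intro cINF_greatest) auto
  have "sublinear r"
  proof (rule sublinearI)
    fix x y
    have comb: "r (x + y) \<le> q x + q' y" if q: "q \<in> Q" and q': "q' \<in> Q" for q q'
      using chain[OF q q']
    proof
      assume "q \<le> q'"
      then have "q y \<le> q' y" by (rule le_funD)
      then show ?thesis
        using r_le[OF q, of "x + y"] sublinear_add[OF sub[OF q], of x y] by linarith
    next
      assume "q' \<le> q"
      then have "q' x \<le> q x" by (rule le_funD)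
      then show ?thesis
        using r_le[OF q', of "x + y"] sublinear_add[OF sub[OF q'], of x y] by linarith
    qed
    have "r (x + y) - q' y \<le> r x" if "q' \<in> Q" for q'
      by (rule r_ge) (use comb that in \<open>simp add: algebra_simps\<close>)
    then have "r (x + y) - r x \<le> r y"
      by (intro r_ge) (simp add: algebra_simps)
    then show "r (x + y) \<le> r x + r y" by simp
  next
    show "r 0 = 0"
      unfolding r_def using ne by (simp add: sub sublinear_zero cong: INF_cong_simp)
  next
    fix t :: real and x :: 'a
    assume t: "0 < t"
    have "r (t *\<^sub>R x) / t \<le> r x"
      by (rule r_ge)
        (use r_le[of _ "t *\<^sub>R x"] t in \<open>simp add: sub sublinear_scaleR divide_le_eq mult.commute\<close>)
    then show "r (t *\<^sub>R x) \<le> t * r x"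
      using t by (simp add: field_simps)
  qed
  then show ?thesis
    using that r_le by (simp add: le_fun_def)
qed

text \<open>If \<open>q (- y) \<noteq> - q y\<close>, then \<open>sublinear_INF_convex\<close> applied to \<open>{y}\<close> makes \<open>q\<close> smaller.\<close>

lemma sublinear_minimal_linear:
  fixes q :: "'a::real_vector \<Rightarrow> real"
  assumes q: "sublinear q" and min: "\<And>r. sublinear r \<Longrightarrow> r \<le> q \<Longrightarrow> r = q"
  shows "linear q"
proof -
  have neg: "q (- y) = - q y" for y
  proof -
    obtain r where r: "sublinear r" "\<And>x. r x \<le> q x" "r (- y) \<le> - q y"
      using sublinear_INF_convex[OF q, of "{y}" "q y"] by auto
    have "r = q" using min r by (simp add: le_fun_def)
    then show ?thesis
      using r(3) sublinear_uminus_ge[OF q, of "- y"] by simp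
  qed
  show ?thesis
  proof
    fix x y
    \<comment> \<open>Since \<open>q\<close> is odd, subadditivity at the negated arguments is
      superadditivity at the original ones.\<close>
    have "q (- x + - y) \<le> q (- x) + q (- y)" by (rule sublinear_add[OF q])
    then have "q x + q y \<le> q (x + y)"
      using neg[of "x + y"] neg[of x] neg[of y] by simp
    then show "q (x + y) = q x + q y"
      using sublinear_add[OF q, of x y] by simp
  next
    fix t x
    show "q (t *\<^sub>R x) = t *\<^sub>R q x"
    proof (cases "0 \<le> t")
      case True then show ?thesis by (simp add: sublinear_scaleR[OF q])
    next
      case False
      then have "q ((- t) *\<^sub>R x) = - t * q x"
        by (intro sublinear_scaleR[OF q]) simp
      then show ?thesis using neg[of "t *\<^sub>R x"] by simp
    qed
  qed
qed

lemma sublinear_dominates_linear: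
  fixes p :: "'a::real_vector \<Rightarrow> real"
  assumes p: "sublinear p"
  obtains L where "linear L" "\<And>x. L x \<le> p x"
proof -
  let ?A = "{q. sublinear q \<and> q \<le> p}"
  \<comment> \<open>Zorn's lemma is applied to the reversed order, so the bound required for a chain
    is a lower bound and the maximal element is a minimal functional.\<close>
  have "\<exists>m\<in>?A. \<forall>q\<in>?A. m \<ge> q \<longrightarrow> q = m"
  proof (rule predicate_Zorn)
    show "partial_order_on ?A (relation_of (\<ge>) ?A)"
      by (rule partial_order_on_relation_ofI) auto
  next
    fix Q assume Q: "Q \<in> Chains (relation_of (\<ge>) ?A)"
    show "\<exists>u\<in>?A. \<forall>q\<in>Q. q \<ge> u"
    proof (cases "Q = {}")
      case True then show ?thesis using p by auto
    next
      case False
      have sub: "Q \<subseteq> ?A" and ch: "\<And>q q'. q \<in> Q \<Longrightarrow> q' \<in> Q \<Longrightarrow> q \<le> q' \<or> q' \<le> q"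
        using Q by (auto simp: Chains_def relation_of_def)
      obtain r where "sublinear r" "\<And>q. q \<in> Q \<Longrightarrow> r \<le> q"
        using sublinear_INF_chain[OF False, of p] sub ch by blast
      then show ?thesis
        using False sub by (intro bexI[of _ r]) (auto intro: order_trans)
    qed
  qed
  then obtain m where m: "sublinear m" "m \<le> p"
    and min: "\<And>q. sublinear q \<Longrightarrow> q \<le> p \<Longrightarrow> q \<le> m \<Longrightarrow> q = m" by auto
  have "linear m"
    using m min by (intro sublinear_minimal_linear) (auto intro: order_trans)
  then show ?thesis
    using that m by (simp add: le_fun_def)
qed

text \<open>Lowering the norm to a sublinear \<open>r\<close> with \<open>r (- c) \<le> - m\<close>
  on \<open>C\<close> and taking a linear \<open>L\<close> below \<open>r\<close> gives both claims:
  \<open>L\<close> is below the norm, and \<open>L c = - L (- c) \<ge> m\<close>.\<close>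

lemma convex_norm_ge_separation:
  fixes C :: "'a::real_normed_vector set"
  assumes C: "convex C" and m: "\<And>c. c \<in> C \<Longrightarrow> m \<le> norm c"
  obtains L :: "'a \<Rightarrow>\<^sub>L real" where "norm L \<le> 1" "\<And>c. c \<in> C \<Longrightarrow> m \<le> L c"
proof (cases "C = {}")
  case True then show ?thesis using that[of 0] by simp
next
  case False
  have "sublinear (norm :: 'a \<Rightarrow> real)"
    by (rule sublinearI) (auto simp: norm_triangle_ineq)
  from sublinear_INF_convex[OF this C False m]
  obtain r :: "'a \<Rightarrow> real" where r: "sublinear r" "\<And>x. r x \<le> norm x" "\<And>c. c \<in> C \<Longrightarrow> r (- c) \<le> - m"
    by blast
  obtain L where L: "linear L" "\<And>x. L x \<le> r x"
    using sublinear_dominates_linear[OF r(1)] by blast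
  have up: "L x \<le> norm x" for x
    using L(2)[of x] r(2)[of x] by simp
  have absL: "norm (L x) \<le> 1 * norm x" for x
    using up[of x] up[of "- x"] by (simp add: linear_neg[OF L(1)] abs_le_iff)
  have bl: "bounded_linear L"
    using L(1) absL by (intro bounded_linear.intro bounded_linear_axioms.intro exI[of _ 1]) auto
  have "norm (Blinfun L) \<le> 1"
    using absL by (intro norm_blinfun_bound) (auto simp: bounded_linear_Blinfun_apply[OF bl])
  moreover have "m \<le> Blinfun L c" if "c \<in> C" for c
    using r(3)[OF that] L(2)[of "- c"]
    by (simp add: bounded_linear_Blinfun_apply[OF bl] linear_neg[OF L(1)])
  ultimately show ?thesis using that by blast
qed

subsection \<open>Distance functions and their subgradients\<close>

text \<open>The norm need not be attained on the unit ball. Symmetry of the ball allows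
  \<open>F x\<close> in place of its absolute value.\<close>

lemma blinfun_norm_approx:
  fixes F :: "'a::real_normed_vector \<Rightarrow>\<^sub>L real"
  assumes "0 < e"
  obtains x where "norm x \<le> 1" "norm F - e < F x"
proof (rule ccontr)
  assume "\<not> thesis"
  then have le: "F x \<le> norm F - e" if "norm x \<le> 1" for x
    using that \<open>norm x \<le> 1 \<Longrightarrow> norm F - e < F x \<Longrightarrow> thesis\<close> by force
  have "norm F \<le> norm F - e"
  proof (rule norm_blinfun_bound)
    show "0 \<le> norm F - e" using le[of 0] by simp
    fix x :: 'a
    show "norm (F x) \<le> (norm F - e) * norm x"
    proof (cases "x = 0")
      case False
      then show ?thesis
        using le[of "x /\<^sub>R norm x"] le[of "- (x /\<^sub>R norm x)"]
        by (simp add: blinfun.scaleR_right blinfun.minus_right abs_le_iff field_simps)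
    qed simp
  qed
  with assms show False by simp
qed

lemma blinfun_bounded_below_eq_0:
  fixes F :: "'a::real_normed_vector \<Rightarrow>\<^sub>L real"
  assumes "\<And>x. b \<le> F x"
  shows "F = 0"
proof (rule blinfun_eqI)
  fix x
  show "F x = blinfun_apply 0 x"
  proof (rule ccontr)
    assume "F x \<noteq> blinfun_apply 0 x"
    then show False
      \<comment> \<open>This multiple of \<open>x\<close> is sent to \<open>b - 1\<close>.\<close>
      using assms[of "((b - 1) / F x) *\<^sub>R x"] by (simp add: blinfun.scaleR_right)
  qed
qed

lemma infdist_approx:
  fixes x :: "'a::real_normed_vector"
  assumes "S \<noteq> {}" "0 < e"
  obtains u where "u \<in> S" "norm (x - u) < infdist x S + e"
proof -
  have "\<exists>u\<in>S. dist x u < infdist x S + e"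
    using assms cINF_less_iff[of S "dist x" "infdist x S + e"]
    by (auto simp: infdist_notempty intro: bdd_belowI2[where m = 0])
  then show ?thesis using that by (auto simp: dist_norm)
qed

lemma infdist_ge:
  fixes x :: "'a::real_normed_vector"
  assumes "S \<noteq> {}" "\<And>u. u \<in> S \<Longrightarrow> a \<le> norm (x - u)"
  shows "a \<le> infdist x S"
  using assms by (auto simp: infdist_notempty dist_norm intro: cINF_greatest)

text \<open>Write \<open>x - u\<close> as \<open>(x - xb) + (xb - u)\<close>: the norm bound
  controls \<open>F\<close> on the whole, the lower bound controls it on the second summand, and the
  infimum over \<open>u\<close> gives the subgradient inequality.\<close>

lemma subdifferential_scaled_infdistI:
  fixes F :: "'a::real_normed_vector \<Rightarrow>\<^sub>L real"
  assumes S: "S \<noteq> {}" and F: "norm F \<le> l" and l: "0 < l"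
    and ge: "\<And>u. u \<in> S \<Longrightarrow> l * infdist xb S \<le> F (xb - u)"
  shows "F /\<^sub>R l \<in> subdifferential (\<lambda>x. infdist x S) xb"
  unfolding subdifferential_def
proof (intro CollectI allI)
  fix x
  have "F (x - xb) / l + infdist xb S \<le> infdist x S"
  proof (rule infdist_ge[OF S])
    fix u assume u: "u \<in> S"
    have "F (x - xb) + F (xb - u) = F (x - u)"
      by (simp flip: blinfun.add_right)
    also have "\<dots> \<le> norm F * norm (x - u)"
      using norm_blinfun[of F "x - u"] by simp
    also have "\<dots> \<le> l * norm (x - u)"
      using F by (intro mult_right_mono) auto
    finally have "F (x - xb) + l * infdist xb S \<le> l * norm (x - u)"
      using ge[OF u] by linarith
    then show "F (x - xb) / l + infdist xb S \<le> norm (x - u)"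
      using l by (simp add: field_simps)
  qed
  then show "blinfun_apply (F /\<^sub>R l) (x - xb) \<le> infdist x S - infdist xb S"
    by (simp add: blinfun.scaleR_left field_simps)
qed

text \<open>Supplies a subgradient for the indices whose multiplier is zero. It comes from
  separation applied to the reflected translate \<open>xb - S\<close>.\<close>

lemma subdifferential_infdist_nonempty:
  fixes S :: "'a::real_normed_vector set"
  assumes S: "S \<noteq> {}" "convex S"
  shows "subdifferential (\<lambda>x. infdist x S) xb \<noteq> {}"
proof -
  have "convex ((\<lambda>u. xb - u) ` S)"
    using convex_translation[OF convex_negations[OF S(2)], of xb] by (simp add: image_image)
  moreover have "infdist xb S \<le> norm c" if "c \<in> (\<lambda>u. xb - u) ` S" for c
    using that by (auto simp flip: dist_norm intro: infdist_le)
  ultimately obtain L :: "'a \<Rightarrow>\<^sub>L real"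
    where "norm L \<le> 1" "\<And>c. c \<in> (\<lambda>u. xb - u) ` S \<Longrightarrow> infdist xb S \<le> L c"
    using convex_norm_ge_separation by blast
  then have "L /\<^sub>R 1 \<in> subdifferential (\<lambda>x. infdist x S) xb"
    by (intro subdifferential_scaled_infdistI S) auto
  then show ?thesis by blast
qed

subsection \<open>Functionals on finite products\<close>

text \<open>Bounded continuous functions on a discrete index space carry the maximum norm, which makes
  \<open>nat \<Rightarrow>\<^sub>C 'a\<close> a substitute for \<open>X\<^sup>n\<close> when \<open>n\<close> is not a type.\<close>

lemma bounded_linear_Bcontfun_single:
  fixes i :: "'i::discrete_topology"
  shows "Bcontfun (\<lambda>j. if j = i then v else 0) j = (if j = i then v else (0::'a::real_normed_vector))"
    and "bounded_linear (\<lambda>v::'a. Bcontfun (\<lambda>j. if j = i then v else 0))"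
proof -
  have ap: "apply_bcontfun (Bcontfun (\<lambda>j. if j = i then v else 0)) = (\<lambda>j. if j = i then v else 0)" for v :: 'a
    by (rule Bcontfun_inverse, rule bcontfun_normI[where b = "norm v"]) auto
  show "Bcontfun (\<lambda>j. if j = i then v else 0) j = (if j = i then v else 0)"
    by (simp add: ap)
  show "bounded_linear (\<lambda>v::'a. Bcontfun (\<lambda>j. if j = i then v else 0))"
    by (intro bounded_linear_intro[where K = 1] bcontfun_eqI) (auto simp: ap intro!: norm_bound)
qed

text \<open>Composing a functional on the product with this coordinate injection extracts its
  component at \<open>i\<close>.\<close>

definition single_bcontfun :: "'i::discrete_topology \<Rightarrow> 'a::real_normed_vector \<Rightarrow>\<^sub>L ('i \<Rightarrow>\<^sub>C 'a)" where
  "single_bcontfun i = Blinfun (\<lambda>v. Bcontfun (\<lambda>j. if j = i then v else 0))"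

lemma single_bcontfun_apply:
  "apply_bcontfun (blinfun_apply (single_bcontfun i) v) j = (if j = i then v else 0)"
  by (simp add: single_bcontfun_def bounded_linear_Blinfun_apply bounded_linear_Bcontfun_single)

lemma sum_bcontfun_apply: "apply_bcontfun (\<Sum>i\<in>I. f i) j = (\<Sum>i\<in>I. apply_bcontfun (f i) j)"
  by (induction I rule: infinite_finite_induct) auto

lemma sum_single_bcontfun_apply:
  assumes "finite I"
  shows "apply_bcontfun (\<Sum>i\<in>I. blinfun_apply (single_bcontfun i) (w i)) j = (if j \<in> I then w j else 0)"
  using assms by (simp add: sum_bcontfun_apply single_bcontfun_apply)

text \<open>The norm dual to a maximum norm is the sum of norms: vectors of the unit ball that
  nearly attain the component norms are assembled into one vector of the unit ball of the
  product.\<close>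

lemma sum_norm_single_le:
  fixes L :: "('i::discrete_topology \<Rightarrow>\<^sub>C 'a::real_normed_vector) \<Rightarrow>\<^sub>L real"
  assumes I: "finite I"
  shows "(\<Sum>i\<in>I. norm (L o\<^sub>L single_bcontfun i)) \<le> norm L"
proof (rule field_le_epsilon)
  fix e :: real assume e: "0 < e"
  \<comment> \<open>The total error over \<open>I\<close> is at most \<open>e\<close>; adding 1
    keeps the denominator positive for empty \<open>I\<close>.\<close>
  define d where "d = e / (real (card I) + 1)"
  have d: "0 < d" using e by (simp add: d_def)
  have "\<exists>v. norm v \<le> 1 \<and> norm (L o\<^sub>L single_bcontfun i) - d < (L o\<^sub>L single_bcontfun i) v" for i
    using blinfun_norm_approx[OF d] by metis
  then obtain v where v: "\<And>i. norm (v i) \<le> 1"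
      "\<And>i. norm (L o\<^sub>L single_bcontfun i) - d < (L o\<^sub>L single_bcontfun i) (v i)"
    by metis
  let ?w = "\<Sum>i\<in>I. blinfun_apply (single_bcontfun i) (v i)"
  have w: "norm ?w \<le> 1"
    using v(1) by (intro norm_bound) (simp add: sum_single_bcontfun_apply[OF I])
  have "(\<Sum>i\<in>I. norm (L o\<^sub>L single_bcontfun i)) \<le> (\<Sum>i\<in>I. (L o\<^sub>L single_bcontfun i) (v i) + d)"
    using v(2) by (intro sum_mono) (simp add: less_imp_le diff_le_eq[symmetric])
  also have "\<dots> = L ?w + real (card I) * d"
    by (simp add: blinfun.sum_right sum.distrib)
  also have "L ?w \<le> norm L"
    using norm_blinfun[of L ?w] mult_left_mono[OF w, of "norm L"] by simp
  also have "real (card I) * d \<le> e"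
    using e by (simp add: d_def field_simps)
  finally show "(\<Sum>i\<in>I. norm (L o\<^sub>L single_bcontfun i)) \<le> norm L + e" by simp
qed

subsection \<open>Multipliers\<close>

lemma max_infdist_ge: "i \<in> {1..n} \<Longrightarrow> infdist x (\<Omega> i) \<le> max_infdist n \<Omega> x"
  by (auto simp: max_infdist_def)

lemma max_infdist_attained:
  assumes "1 \<le> n"
  obtains i where "i \<in> {1..n}" "max_infdist n \<Omega> x = infdist x (\<Omega> i)"
proof -
  have "max_infdist n \<Omega> x \<in> (\<lambda>i. infdist x (\<Omega> i)) ` {1..n}"
    unfolding max_infdist_def using assms by (intro Max_in) auto
  then show ?thesis using that by blast
qed

lemma Sol_iff: "x \<in> Sol n \<Omega> \<longleftrightarrow> (\<forall>y. max_infdist n \<Omega> x \<le> max_infdist n \<Omega> y)"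
  by (auto simp: Sol_def is_arg_min_def not_less)

lemma subdifferentialD: "xs \<in> subdifferential g x \<Longrightarrow> blinfun_apply xs (y - x) \<le> g y - g x"
  by (simp add: subdifferential_def)

section \<open>Sufficiency of the multiplier condition and description of the solution set\<close>

context
  fixes n :: nat and \<Omega> :: "nat \<Rightarrow> 'a::real_normed_vector set"
    and l :: "nat \<Rightarrow> real" and xs :: "nat \<Rightarrow> 'a \<Rightarrow>\<^sub>L real"
  assumes nonneg: "\<And>i. i \<in> {1..n} \<Longrightarrow> 0 \<le> l i"
    and sum_one: "(\<Sum>i=1..n. l i) = 1"
    and sum_zero: "(\<Sum>i=1..n. l i *\<^sub>R xs i) = 0"
begin

lemma multiplier_sum_apply: "(\<Sum>i=1..n. l i * xs i v) = 0"
  using arg_cong[OF sum_zero, of "\<lambda>F. blinfun_apply F v"]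
  by (simp add: blinfun.sum_left blinfun.scaleR_left)

lemma multiplier_sum_max: "(\<Sum>i=1..n. l i * max_infdist n \<Omega> x) = max_infdist n \<Omega> x"
  using sum_one by (simp flip: sum_distrib_right)

text \<open>At \<open>x\<close> the distances with positive weight all equal the maximum, so it is
  their weighted mean; the weighted subgradients cancel, and summing their inequalities compares it
  with the maximum at \<open>y\<close>.\<close>

lemma in_Sol_of_multipliers:
  assumes "\<And>i. i \<in> {1..n} \<Longrightarrow> 0 < l i \<Longrightarrow> x \<in> B_set n \<Omega> i (xs i)"
  shows "x \<in> Sol n \<Omega>"
  unfolding Sol_iff
proof
  fix y
  have "max_infdist n \<Omega> x = (\<Sum>i=1..n. l i * max_infdist n \<Omega> x + l i * xs i (y - x))"
    by (simp add: sum.distrib multiplier_sum_max multiplier_sum_apply del: One_nat_def)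
  also have "\<dots> \<le> (\<Sum>i=1..n. l i * max_infdist n \<Omega> y)"
  proof (rule sum_mono)
    fix i assume i: "i \<in> {1..n}"
    show "l i * max_infdist n \<Omega> x + l i * xs i (y - x) \<le> l i * max_infdist n \<Omega> y"
    proof (cases "l i = 0")
      case False
      then have "0 < l i" using nonneg[OF i] by simp
      then have "max_infdist n \<Omega> x + xs i (y - x) \<le> infdist y (\<Omega> i)"
        using assms[OF i] subdifferentialD[of "xs i" "\<lambda>x. infdist x (\<Omega> i)" x y]
        by (simp add: B_set_def A_set_def C_set_def)
      then show ?thesis
        using max_infdist_ge[OF i, of y \<Omega>] nonneg[OF i]
        by (simp add: mult_left_mono flip: distrib_left)
    qed simp
  qed
  finally show "max_infdist n \<Omega> x \<le> max_infdist n \<Omega> y"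
    by (simp add: multiplier_sum_max del: One_nat_def)
qed

lemma Sol_subset_B_set:
  assumes xb: "xb \<in> Sol n \<Omega>"
    and sub: "\<And>i. i \<in> {1..n} \<Longrightarrow> xs i \<in> subdifferential (\<lambda>x. infdist x (\<Omega> i)) xb"
    and compl: "\<And>i. i \<in> {1..n} \<Longrightarrow> (infdist xb (\<Omega> i) - max_infdist n \<Omega> xb) * l i = 0"
    and x: "x \<in> Sol n \<Omega>" and i: "i \<in> {1..n}" "0 < l i"
  shows "x \<in> B_set n \<Omega> i (xs i)"
proof -
  \<comment> \<open>Each summand collects two nonnegative defects, that of the subgradient
    inequality from \<open>xb\<close> to \<open>x\<close> and that of the distance to the maximum at
    \<open>x\<close>. Their total is zero, so both vanish where the weight is positive.\<close>
  define s where "s j = l j * (infdist x (\<Omega> j) - infdist xb (\<Omega> j) - xs j (x - xb))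
    + l j * (max_infdist n \<Omega> x - infdist x (\<Omega> j))" for j
  have eq: "max_infdist n \<Omega> x = max_infdist n \<Omega> xb"
    using x xb by (auto simp: Sol_iff intro: antisym)
  have s: "s j = l j * max_infdist n \<Omega> x - l j * max_infdist n \<Omega> xb - l j * xs j (x - xb)"
    if "j \<in> {1..n}" for j
    using compl[OF that] by (auto simp: s_def algebra_simps)
  have p1: "0 \<le> l j * (infdist x (\<Omega> j) - infdist xb (\<Omega> j) - xs j (x - xb))" if "j \<in> {1..n}" for j
    using nonneg[OF that] subdifferentialD[OF sub[OF that], of x] by simp
  have p2: "0 \<le> l j * (max_infdist n \<Omega> x - infdist x (\<Omega> j))" if "j \<in> {1..n}" for j
    using nonneg[OF that] max_infdist_ge[OF that, of x \<Omega>] by simp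
  have "(\<Sum>j=1..n. s j) = 0"
    by (simp add: s sum_subtractf sum_negf multiplier_sum_max multiplier_sum_apply eq del: One_nat_def)
  then have "s i = 0"
    using sum_nonneg_0[of "{1..n}" s i] p1 p2 i by (simp add: s_def)
  then have "l i * (infdist x (\<Omega> i) - infdist xb (\<Omega> i) - xs i (x - xb)) = 0"
     "l i * (max_infdist n \<Omega> x - infdist x (\<Omega> i)) = 0"
    using p1[OF i(1)] p2[OF i(1)] unfolding s_def by linarith+
  then have e: "infdist x (\<Omega> i) = infdist xb (\<Omega> i) + xs i (x - xb)"
      "infdist x (\<Omega> i) = max_infdist n \<Omega> x"
    using i by auto
  \<comment> \<open>Equality in the subgradient inequality at \<open>x\<close> allows the base point
    to be moved from \<open>xb\<close> to \<open>x\<close>.\<close>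
  have "xs i (y - x) \<le> infdist y (\<Omega> i) - infdist x (\<Omega> i)" for y
  proof -
    have "xs i (y - x) + xs i (x - xb) = xs i (y - xb)"
      by (simp flip: blinfun.add_right)
    then show ?thesis
      using subdifferentialD[OF sub[OF i(1)], of y] e(1) by simp
  qed
  then show ?thesis
    using e(2) by (simp add: B_set_def A_set_def C_set_def subdifferential_def)
qed

end

section \<open>Necessity: multipliers from separation in the product space\<close>

lemma separating_functionals:
  fixes \<Omega> :: "nat \<Rightarrow> 'a::real_normed_vector set"
  assumes n: "1 \<le> n" and ne: "\<And>i. i \<in> {1..n} \<Longrightarrow> \<Omega> i \<noteq> {}"
    and conv: "\<And>i. i \<in> {1..n} \<Longrightarrow> convex (\<Omega> i)"
    and m: "\<And>x. m \<le> max_infdist n \<Omega> x"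
  obtains F :: "nat \<Rightarrow> 'a \<Rightarrow>\<^sub>L real"
    where "(\<Sum>i=1..n. norm (F i)) \<le> 1" "(\<Sum>i=1..n. F i) = 0"
      "\<And>x u. (\<And>i. i \<in> {1..n} \<Longrightarrow> u i \<in> \<Omega> i) \<Longrightarrow> m \<le> (\<Sum>i=1..n. F i (x - u i))"
proof -
  define E where "E w = (\<Sum>i=1..n. blinfun_apply (single_bcontfun i) (w i))" for w :: "nat \<Rightarrow> 'a"
  have E: "apply_bcontfun (E w) j = (if j \<in> {1..n} then w j else 0)" for w j
    unfolding E_def by (rule sum_single_bcontfun_apply) simp
  \<comment> \<open>All difference families with a common \<open>x\<close>, so that the maximum norm
    of an element bounds every distance from \<open>x\<close> to the sets.\<close>
  define C where "C = {E (\<lambda>i. x - u i) |x u. \<forall>i\<in>{1..n}. u i \<in> \<Omega> i}"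
  have "convex C"
  proof (rule convexI)
    fix c c' and s t :: real
    assume "c \<in> C" "c' \<in> C" and st: "0 \<le> s" "0 \<le> t" "s + t = 1"
    then obtain x u y v where c: "c = E (\<lambda>i. x - u i)" "\<And>i. i \<in> {1..n} \<Longrightarrow> u i \<in> \<Omega> i"
      and c': "c' = E (\<lambda>i. y - v i)" "\<And>i. i \<in> {1..n} \<Longrightarrow> v i \<in> \<Omega> i"
      unfolding C_def by blast
    have "s *\<^sub>R c + t *\<^sub>R c' = E (\<lambda>i. (s *\<^sub>R x + t *\<^sub>R y) - (s *\<^sub>R u i + t *\<^sub>R v i))"
      by (rule bcontfun_eqI) (simp add: c c' E algebra_simps)
    moreover have "s *\<^sub>R u i + t *\<^sub>R v i \<in> \<Omega> i" if "i \<in> {1..n}" for i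
      using that st by (intro convexD[OF conv] c c')
    ultimately show "s *\<^sub>R c + t *\<^sub>R c' \<in> C"
      unfolding C_def by fast
  qed
  moreover have "m \<le> norm c" if "c \<in> C" for c
  proof -
    obtain x u where c: "c = E (\<lambda>i. x - u i)" "\<And>i. i \<in> {1..n} \<Longrightarrow> u i \<in> \<Omega> i"
      using \<open>c \<in> C\<close> unfolding C_def by blast
    obtain i where i: "i \<in> {1..n}" "max_infdist n \<Omega> x = infdist x (\<Omega> i)"
      using max_infdist_attained[OF n] .
    have "m \<le> norm (x - u i)"
      using m[of x] infdist_le[OF c(2)[OF i(1)], of x] i(2) by (simp add: dist_norm)
    also have "\<dots> \<le> norm c"
      using norm_bounded[of c i] i(1) by (simp add: c E)
    finally show ?thesis .
  qed
  ultimately obtain L :: "(nat \<Rightarrow>\<^sub>C 'a) \<Rightarrow>\<^sub>L real" where L: "norm L \<le> 1" "\<And>c. c \<in> C \<Longrightarrow> m \<le> L c"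
    using convex_norm_ge_separation by blast
  define F where "F i = L o\<^sub>L single_bcontfun i" for i
  have LE: "L (E w) = (\<Sum>i=1..n. F i (w i))" for w
    by (simp add: E_def F_def blinfun.sum_right)
  have sep: "m \<le> (\<Sum>i=1..n. F i (x - u i))" if "\<And>i. i \<in> {1..n} \<Longrightarrow> u i \<in> \<Omega> i" for x u
    using L(2)[of "E (\<lambda>i. x - u i)"] that unfolding LE C_def by blast
  have "(\<Sum>i=1..n. norm (F i)) \<le> 1"
    using sum_norm_single_le[of "{1..n}" L] L(1) by (simp add: F_def)
  moreover have "(\<Sum>i=1..n. F i) = 0"
  proof -
    have "\<forall>i\<in>{1..n}. \<exists>v. v \<in> \<Omega> i" using ne by blast
    then obtain u where "\<And>i. i \<in> {1..n} \<Longrightarrow> u i \<in> \<Omega> i" by metis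
    \<comment> \<open>With \<open>u\<close> fixed and \<open>x\<close> free, the sum of the
      functionals is bounded below on the whole space.\<close>
    then have "m + (\<Sum>i=1..n. F i (u i)) \<le> blinfun_apply (\<Sum>i=1..n. F i) x" for x
      using sep[of u x] by (simp add: blinfun.sum_left blinfun.diff_right sum_subtractf)
    then show ?thesis by (rule blinfun_bounded_below_eq_0)
  qed
  ultimately show ?thesis using that sep by blast
qed

lemma multipliers_exist:
  fixes \<Omega> :: "nat \<Rightarrow> 'a::real_normed_vector set"
  assumes n: "1 \<le> n" and ne: "\<And>i. i \<in> {1..n} \<Longrightarrow> \<Omega> i \<noteq> {}"
    and conv: "\<And>i. i \<in> {1..n} \<Longrightarrow> convex (\<Omega> i)"
    and xb: "xb \<in> Sol n \<Omega>" and pos: "0 < max_infdist n \<Omega> xb"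
  obtains l xs where "\<And>i. 0 \<le> l i"
    "\<And>i. i \<in> {1..n} \<Longrightarrow> xs i \<in> subdifferential (\<lambda>x. infdist x (\<Omega> i)) xb"
    "multiplier_system n \<Omega> xb l xs"
proof -
  define m where "m = max_infdist n \<Omega> xb"
  define d where "d i = infdist xb (\<Omega> i)" for i
  have dm: "d i \<le> m" if "i \<in> {1..n}" for i
    using max_infdist_ge[OF that] by (simp add: d_def m_def)
  have "\<And>x. m \<le> max_infdist n \<Omega> x" using xb by (simp add: Sol_iff m_def)
  from separating_functionals[OF n ne conv this]
  obtain F :: "nat \<Rightarrow> 'a \<Rightarrow>\<^sub>L real"
    where F: "(\<Sum>i=1..n. norm (F i)) \<le> 1" "(\<Sum>i=1..n. F i) = 0"
      "\<And>x u. (\<And>i. i \<in> {1..n} \<Longrightarrow> u i \<in> \<Omega> i) \<Longrightarrow> m \<le> (\<Sum>i=1..n. F i (x - u i))"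
    by metis
  define l where "l i = norm (F i)" for i
  have l0: "0 \<le> l i" for i by (simp add: l_def)
  \<comment> \<open>Only coordinate \<open>j\<close> keeps its point \<open>u\<close>; in the
    others, nearly closest points replace the values of \<open>F i\<close> by
    \<open>l i * d i\<close> up to a total error of \<open>e\<close>.\<close>
  have near: "m - (\<Sum>i\<in>{1..n}-{j}. l i * d i) \<le> F j (xb - u)"
    if j: "j \<in> {1..n}" and u: "u \<in> \<Omega> j" for j u
  proof (rule field_le_epsilon)
    fix e :: real assume e: "0 < e"
    have "\<exists>u. i \<in> {1..n} \<longrightarrow> u \<in> \<Omega> i \<and> norm (xb - u) < d i + e" for i
      using infdist_approx[OF ne e, of i xb] unfolding d_def by metis
    then obtain v where v: "\<And>i. i \<in> {1..n} \<Longrightarrow> v i \<in> \<Omega> i \<and> norm (xb - v i) < d i + e"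
      by metis
    have "m \<le> (\<Sum>i=1..n. F i (xb - (if i = j then u else v i)))"
      using u v by (intro F(3)) auto
    also have "\<dots> = F j (xb - u) + (\<Sum>i\<in>{1..n}-{j}. F i (xb - v i))"
      using j by (simp add: sum.remove)
    also have "(\<Sum>i\<in>{1..n}-{j}. F i (xb - v i)) \<le> (\<Sum>i\<in>{1..n}-{j}. l i * d i + l i * e)"
    proof (rule sum_mono)
      fix i assume i: "i \<in> {1..n} - {j}"
      have "F i (xb - v i) \<le> l i * norm (xb - v i)"
        using norm_blinfun[of "F i" "xb - v i"] by (simp add: l_def)
      also have "\<dots> \<le> l i * (d i + e)"
        using v[of i] i l0[of i] by (intro mult_left_mono) auto
      finally show "F i (xb - v i) \<le> l i * d i + l i * e" by (simp add: algebra_simps)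
    qed
    also have "\<dots> = (\<Sum>i\<in>{1..n}-{j}. l i * d i) + (\<Sum>i\<in>{1..n}-{j}. l i) * e"
      by (simp add: sum.distrib sum_distrib_right)
    also have "(\<Sum>i\<in>{1..n}-{j}. l i) * e \<le> 1 * e"
    proof (rule mult_right_mono)
      have "(\<Sum>i\<in>{1..n}-{j}. l i) \<le> (\<Sum>i=1..n. l i)"
        using l0 by (intro sum_mono2) auto
      then show "(\<Sum>i\<in>{1..n}-{j}. l i) \<le> 1" using F(1) by (simp add: l_def)
    qed (use e in simp)
    finally show "m - (\<Sum>i\<in>{1..n}-{j}. l i * d i) \<le> F j (xb - u) + e" by simp
  qed
  \<comment> \<open>Approaching the distance in the remaining coordinate as well, here the first,
    bounds \<open>m\<close> by the full weighted sum.\<close>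
  have m_le: "m \<le> (\<Sum>i=1..n. l i * d i)"
  proof (rule field_le_epsilon)
    fix e :: real assume e: "0 < e"
    have j: "1 \<in> {1..n}" using n by simp
    obtain u where u: "u \<in> \<Omega> 1" "norm (xb - u) < d 1 + e"
      using infdist_approx[OF ne[OF j] e] unfolding d_def by blast
    have "F 1 (xb - u) \<le> l 1 * norm (xb - u)"
      using norm_blinfun[of "F 1" "xb - u"] by (simp add: l_def)
    also have "\<dots> \<le> l 1 * (d 1 + e)"
      using u l0 by (intro mult_left_mono) auto
    also have "l 1 * e \<le> 1 * e"
      using member_le_sum[OF j, of l] l0 e F(1) by (intro mult_right_mono) (auto simp: l_def)
    then have "l 1 * (d 1 + e) \<le> l 1 * d 1 + e" by (simp add: algebra_simps)
    finally show "m \<le> (\<Sum>i=1..n. l i * d i) + e"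
      using near[OF j u(1)] by (simp add: sum.remove[OF _ j] del: One_nat_def)
  qed
  have le_m: "(\<Sum>i=1..n. l i * d i) \<le> (\<Sum>i=1..n. l i * m)"
    using dm l0 by (intro sum_mono mult_left_mono) auto
  have sum_l: "(\<Sum>i=1..n. l i) = 1"
  proof (rule antisym)
    \<comment> \<open>Cancelling the positive \<open>m\<close> shows that the weights sum to at
      least 1.\<close>
    have "1 * m \<le> (\<Sum>i=1..n. l i) * m"
      using m_le le_m by (simp add: sum_distrib_right)
    then show "1 \<le> (\<Sum>i=1..n. l i)"
      using pos by (simp add: m_def)
  qed (use F(1) in \<open>simp add: l_def\<close>)
  have sum_d: "(\<Sum>i=1..n. l i * d i) = m"
    using m_le le_m sum_l by (simp flip: sum_distrib_right)
  have "(\<Sum>i=1..n. l i * (m - d i)) = 0"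
    using sum_d sum_l by (simp add: right_diff_distrib sum_subtractf flip: sum_distrib_right)
  then have compl: "(d i - m) * l i = 0" if "i \<in> {1..n}" for i
    using that dm l0 by (subst (asm) sum_nonneg_eq_0_iff) auto
  \<comment> \<open>For \<open>l i = 0\<close> the functional \<open>F i\<close> vanishes and any
    subgradient fits. Otherwise the left side of \<open>near\<close> is exactly
    \<open>l i * d i\<close>, as the weighted distances sum to \<open>m\<close>, and
    \<open>F i\<close> divided by its norm is a subgradient.\<close>
  have "\<exists>xi. xi \<in> subdifferential (\<lambda>x. infdist x (\<Omega> i)) xb \<and> F i = l i *\<^sub>R xi"
    if i: "i \<in> {1..n}" for i
  proof (cases "l i = 0")
    case True
    then show ?thesis
      using subdifferential_infdist_nonempty[OF ne[OF i] conv[OF i], of xb] by (auto simp: l_def)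
  next
    case False
    have "l i * infdist xb (\<Omega> i) \<le> F i (xb - u)" if "u \<in> \<Omega> i" for u
      using near[OF i that] sum_d sum.remove[OF _ i, of "\<lambda>i. l i * d i"] unfolding d_def by simp
    then have "F i /\<^sub>R l i \<in> subdifferential (\<lambda>x. infdist x (\<Omega> i)) xb"
      using False l0[of i] by (intro subdifferential_scaled_infdistI ne i) (auto simp: l_def)
    then show ?thesis using False by force
  qed
  then obtain xs where xs: "\<And>i. i \<in> {1..n} \<Longrightarrow> xs i \<in> subdifferential (\<lambda>x. infdist x (\<Omega> i)) xb"
      "\<And>i. i \<in> {1..n} \<Longrightarrow> F i = l i *\<^sub>R xs i"
    by metis
  have "multiplier_system n \<Omega> xb l xs"
    using F(2) sum_l compl xs(2) by (auto simp: multiplier_system_def d_def m_def)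
  then show ?thesis using that l0 xs(1) by blast
qed

theorem theorem5p1:
  fixes \<Omega> :: "nat \<Rightarrow> 'a::real_normed_vector set" and n :: nat and xb :: 'a
  assumes "n \<ge> 2"
    and "\<And>i. i \<in> {1..n} \<Longrightarrow> \<Omega> i \<noteq> {}"
    and "\<And>i. i \<in> {1..n} \<Longrightarrow> closed (\<Omega> i)"
    and "\<And>i. i \<in> {1..n} \<Longrightarrow> convex (\<Omega> i)"
    and "xb \<notin> (\<Union>i\<in>{1..n}. \<Omega> i)"
  shows "(xb \<in> Sol n \<Omega> \<longleftrightarrow>
           (\<exists>(l :: nat \<Rightarrow> real) (xs :: nat \<Rightarrow> 'a \<Rightarrow>\<^sub>L real).
              (\<forall>i\<in>{1..n}. l i \<ge> 0) \<and>
              (\<forall>i\<in>{1..n}. xs i \<in> subdifferential (\<lambda>x. infdist x (\<Omega> i)) xb) \<and>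
              multiplier_system n \<Omega> xb l xs)) \<and>
         (\<forall>(l :: nat \<Rightarrow> real) (xs :: nat \<Rightarrow> 'a \<Rightarrow>\<^sub>L real).
              (\<forall>i\<in>{1..n}. l i \<ge> 0) \<longrightarrow>
              (\<forall>i\<in>{1..n}. xs i \<in> subdifferential (\<lambda>x. infdist x (\<Omega> i)) xb) \<longrightarrow>
              multiplier_system n \<Omega> xb l xs \<longrightarrow>
              Sol n \<Omega> = (\<Inter>i\<in>{i\<in>{1..n}. l i > 0}. B_set n \<Omega> i (xs i)))"
proof -
  have n: "1 \<le> n" using \<open>n \<ge> 2\<close> by simp
  have Sol: "xb \<in> Sol n \<Omega>"
    if "\<forall>i\<in>{1..n}. 0 \<le> l i" "\<forall>i\<in>{1..n}. xs i \<in> subdifferential (\<lambda>x. infdist x (\<Omega> i)) xb"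
      "multiplier_system n \<Omega> xb l xs" for l xs
    \<comment> \<open>Complementarity places \<open>xb\<close> itself in each \<open>B_set\<close>
      with positive weight.\<close>
    using that
    by (intro in_Sol_of_multipliers[of n l xs])
      (auto simp: multiplier_system_def B_set_def A_set_def C_set_def)
  have ex: "\<exists>l xs. (\<forall>i\<in>{1..n}. 0 \<le> l i) \<and>
      (\<forall>i\<in>{1..n}. xs i \<in> subdifferential (\<lambda>x. infdist x (\<Omega> i)) xb) \<and> multiplier_system n \<Omega> xb l xs"
    if xb: "xb \<in> Sol n \<Omega>"
  proof -
    \<comment> \<open>Closedness makes the distance to a set missing \<open>xb\<close> positive; one
      such set makes the maximum positive.\<close>
    have "infdist xb (\<Omega> 1) \<noteq> 0"
      using assms n in_closed_iff_infdist_zero[of "\<Omega> 1" xb] by auto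
    then have "0 < max_infdist n \<Omega> xb"
      using max_infdist_ge[of 1 n xb \<Omega>] infdist_nonneg[of xb "\<Omega> 1"] n by simp
    from multipliers_exist[OF n assms(2,4) xb this] show ?thesis by metis
  qed
  have "Sol n \<Omega> = (\<Inter>i\<in>{i\<in>{1..n}. l i > 0}. B_set n \<Omega> i (xs i))"
    if h: "\<forall>i\<in>{1..n}. 0 \<le> l i" "\<forall>i\<in>{1..n}. xs i \<in> subdifferential (\<lambda>x. infdist x (\<Omega> i)) xb"
      "multiplier_system n \<Omega> xb l xs" for l xs
  proof (intro equalityI subsetI)
    fix x assume "x \<in> Sol n \<Omega>"
    then show "x \<in> (\<Inter>i\<in>{i\<in>{1..n}. l i > 0}. B_set n \<Omega> i (xs i))"
      using h Sol[OF h] Sol_subset_B_set[of n l xs xb \<Omega> x] by (auto simp: multiplier_system_def)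
  next
    fix x assume "x \<in> (\<Inter>i\<in>{i\<in>{1..n}. l i > 0}. B_set n \<Omega> i (xs i))"
    then show "x \<in> Sol n \<Omega>"
      using h by (intro in_Sol_of_multipliers[of n l xs]) (auto simp: multiplier_system_def)
  qed
  then show ?thesis using Sol ex by blast
qed

end
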